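(* Consider the causal adversarial multi-path network model with passive feedback described in the context, with $C$ unit-capacity links, additive jamming, and no secrecy requirement. For any $\vec z=(z_{rw},z_{ro},z_{wo})$ with $z_{rw}+z_{ro}+z_{wo}\le C$, writing $z_r=z_{rw}+z_{ro}$ and $z_w=z_{rw}+z_{wo}$, the capacity is $$R=\begin{cases} 0 & \text{if } z_r=C \text{ and } C\le 2z_w,\\ C-z_w & \text{otherwise.}\end{cases}$$
   Context: Model. A sender (Alice) communicates with a receiver (Bob) over $C$ parallel directed noiseless links $L_1,\dots,L_C$, each of unit capacity (large-alphabet regime). A code of block length $n$ and rate $R$ has message $M$ uniform on $\{0,1\}^{nR}$ and uses private randomness of Alice unknown to the adversary. Passive feedback: the code may operate in $r\ge1$ rounds of lengths $n^{(1)},\dots,n^{(r)}$ summing to $n$; in round $k$ Alice sends codewords $\vec X^{(k)}_1,\dots,\vec X^{(k)}_C$ which are functions of the message, her randomness, and all words $\vec Y^{(1)},\dots,\vec Y^{(k-1)}$ received by Bob in earlier rounds (Alice observes everything Bob receives, causally). Bob decodes $\hat M$ from all received words. Adversary. Calvin, who knows the coding scheme, selects pairwise disjoint link sets $Z_{rw},Z_{ro},Z_{wo}$ (unknown to Alice and Bob) with $|Z_{rw}|\le z_{rw}$, $|Z_{ro}|\le z_{ro}$, $|Z_{wo}|\le z_{wo}$; he reads the links in $Z_r=Z_{rw}\cup Z_{ro}$ and jams the links in $Z_w=Z_{rw}\cup Z_{wo}$. He is causal: his jamming of the symbols at time $t$ may depend only on symbols observed on $Z_r$ up to and including time $t$.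 Under additive jamming $\vec Y_i=\vec X_i+\vec E_i$ with $\vec E_i$ chosen by Calvin and $\vec E_i=0$ for $i\notin Z_w$ (so on links of $Z_{wo}$ Calvin does not learn the received symbols); under overwrite jamming $\vec Y_i=\vec E_i$ for $i\in Z_w$ and $\vec Y_i=\vec X_i$ otherwise. Rate $R$ is achievable if for every $\varepsilon>0$ and all sufficiently large $n$ there is such a code with $\Pr[\hat M\ne M]<\varepsilon$ against every admissible causal adversary; the capacity is the supremum of achievable rates. *)

theory Defs
  imports "HOL-Probability.Probability"
begin

text \<open>
Conventions.  Links are indexed by 0..<C, time steps by 0..<n.  A word array
Y :: nat => nat => nat maps (time s, link i) to the symbol in Z_q (values 0..<q).
Round lengths are given by a nonempty list ns with sum n; rstart ns t is the
starting time of the round containing time t.  Alice's private randomness is a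
discrete distribution W :: nat pmf.  The adversary is deterministic (randomised
adversaries are mixtures of deterministic ones, so this loses nothing).
\<close>

definition trunc :: "nat \<Rightarrow> (nat \<Rightarrow> nat \<Rightarrow> nat) \<Rightarrow> (nat \<Rightarrow> nat \<Rightarrow> nat)" where
  "trunc k Y = (\<lambda>s i. if s < k then Y s i else 0)"

definition rstart :: "nat list \<Rightarrow> nat \<Rightarrow> nat" where
  "rstart ns t = Max {sum_list (take k ns) | k. k \<le> length ns \<and> sum_list (take k ns) \<le> t}"

definition xsym :: "nat \<Rightarrow> (nat \<Rightarrow> nat \<Rightarrow> (nat \<Rightarrow> nat \<Rightarrow> nat) \<Rightarrow> nat \<Rightarrow> nat \<Rightarrow> nat)
    \<Rightarrow> nat list \<Rightarrow> nat \<Rightarrow> nat \<Rightarrow> (nat \<Rightarrow> nat \<Rightarrow> nat) \<Rightarrow> nat \<Rightarrow> nat \<Rightarrow> nat" where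
  "xsym q enc ns m w Y s i = enc m w (trunc (rstart ns s) Y) s i mod q"

text \<open>Received array after the first t time steps (entries at times \<ge> t and
links \<ge> C are 0), under additive causal jamming.  At time t Calvin sees the
transmitted symbols on links in Zr at times \<le> t and adds adv t obs i on links
i in Zw.\<close>
fun run :: "nat \<Rightarrow> nat \<Rightarrow> (nat \<Rightarrow> nat \<Rightarrow> (nat \<Rightarrow> nat \<Rightarrow> nat) \<Rightarrow> nat \<Rightarrow> nat \<Rightarrow> nat)
    \<Rightarrow> nat list \<Rightarrow> nat set \<Rightarrow> nat set \<Rightarrow> (nat \<Rightarrow> (nat \<Rightarrow> nat \<Rightarrow> nat) \<Rightarrow> nat \<Rightarrow> nat)
    \<Rightarrow> nat \<Rightarrow> nat \<Rightarrow> nat \<Rightarrow> (nat \<Rightarrow> nat \<Rightarrow> nat)" where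
  "run q C enc ns Zr Zw adv m w 0 = (\<lambda>s i. 0)"
| "run q C enc ns Zr Zw adv m w (Suc t) =
     (let Y = run q C enc ns Zr Zw adv m w t;
          obs = (\<lambda>s j. if s \<le> t \<and> j \<in> Zr then xsym q enc ns m w Y s j else 0);
          E = (\<lambda>i. if i \<in> Zw then adv t obs i else 0)
      in (\<lambda>s i. if s = t \<and> i < C then (xsym q enc ns m w Y t i + E i) mod q else Y s i))"

definition err_prob where
  "err_prob q C n ns K enc dec W Zr Zw adv =
     (\<Sum>m<K. measure_pmf.prob W {w. dec (run q C enc ns Zr Zw adv m w n) \<noteq> m}) / real K"

definition admissible_sets :: "nat \<Rightarrow> nat \<Rightarrow> nat \<Rightarrow> nat \<Rightarrow> nat set \<Rightarrow> nat set \<Rightarrow> nat set \<Rightarrow> bool" where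
  "admissible_sets C zrw zro zwo Zrw Zro Zwo \<longleftrightarrow>
     Zrw \<union> Zro \<union> Zwo \<subseteq> {..<C} \<and>
     Zrw \<inter> Zro = {} \<and> Zrw \<inter> Zwo = {} \<and> Zro \<inter> Zwo = {} \<and>
     card Zrw \<le> zrw \<and> card Zro \<le> zro \<and> card Zwo \<le> zwo"

text \<open>Rate R (in units of log q per link use, i.e. unit-capacity links) with
alphabet Z_q, q chosen by the code designer (large-alphabet regime).\<close>
definition achievable :: "nat \<Rightarrow> nat \<Rightarrow> nat \<Rightarrow> nat \<Rightarrow> real \<Rightarrow> bool" where
  "achievable C zrw zro zwo R \<longleftrightarrow>
     (\<forall>\<epsilon>>0. \<exists>N. \<forall>n\<ge>N. \<exists>q::nat. q \<ge> 2 \<and>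
        (\<exists>ns enc dec W. ns \<noteq> [] \<and> sum_list ns = n \<and>
          (\<forall>Zrw Zro Zwo adv. admissible_sets C zrw zro zwo Zrw Zro Zwo \<longrightarrow>
             err_prob q C n ns (nat \<lceil>real q powr (real n * R)\<rceil>) enc dec W
               (Zrw \<union> Zro) (Zrw \<union> Zwo) adv < \<epsilon>)))"

definition capacity :: "nat \<Rightarrow> nat \<Rightarrow> nat \<Rightarrow> nat \<Rightarrow> real" where
  "capacity C zrw zro zwo = Sup {R. achievable C zrw zro zwo R}"

end

theory Submission
  imports Defs "HOL-Computational_Algebra.Polynomial" "HOL-Computational_Algebra.Primes"
    "HOL-Number_Theory.Cong" "HOL-Real_Asymp.Real_Asymp"
begin

text \<open>
  Converse. If Calvin adds uniform noise on \<open>z\<^sub>w\<close> links, these links carry no information, so rates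
  above \<open>C - z\<^sub>w\<close> fail. If he reads all links and \<open>C \<le> 2 z\<^sub>w\<close>, he simulates Alice with an independent
  message on half of the links; Bob cannot tell which half is genuine.

  Achievability. Alice sends the payload with a Reed-Solomon code of dimension \<open>k = C - z\<^sub>w\<close> across
  the links. By feedback she knows the set of jammed links; once Bob learns this set, he decodes the
  erasures. Only the set, one of \<open>2\<^sup>C\<close> values, has to be conveyed reliably in the last time step.
  If \<open>2 z\<^sub>w < C\<close>, she sends it on all links and Bob takes the majority. If some link is not read, she
  sends \<open>2\<^sup>C\<close> random symbols on every link after the payload; the sums over the links of the symbols
  received are keys shared with Bob, uniform for Calvin since jamming is additive. She then announces
  the set number \<open>d\<close> by sending the key number \<open>d\<close> on all links. Some link is not jammed, and imitating
  a different set means guessing an unseen key, which succeeds with probability \<open>O(1/q)\<close>.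
\<close>

type_synonym array = "nat \<Rightarrow> nat \<Rightarrow> nat"
type_synonym encoder = "nat \<Rightarrow> nat \<Rightarrow> array \<Rightarrow> array"
type_synonym jammer = "nat \<Rightarrow> array \<Rightarrow> nat \<Rightarrow> nat"

section \<open>Independent and uniform random variables\<close>

lemma prob_pair_pmf_le_given_fst:
  assumes "\<And>x. x \<in> set_pmf p \<Longrightarrow> measure_pmf.prob q {y. (x, y) \<in> S} \<le> c"
  shows "measure_pmf.prob (pair_pmf p q) S \<le> c"
proof -
  obtain x where "x \<in> set_pmf p" using set_pmf_not_empty by fast
  then have "0 \<le> c" using assms measure_nonneg by (blast intro: order_trans)
  have "emeasure (pair_pmf p q) S = (\<integral>\<^sup>+x. emeasure q {y. (x, y) \<in> S} \<partial>p)"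
    by (simp add: pair_pmf_def flip: map_pmf_def) (simp add: vimage_def)
  also have "\<dots> \<le> (\<integral>\<^sup>+x. ennreal c \<partial>p)"
    by (intro nn_integral_mono_AE AE_pmfI) (simp add: measure_pmf.emeasure_eq_measure ennreal_leI assms)
  also have "\<dots> = ennreal c" by simp
  finally show ?thesis using \<open>0 \<le> c\<close> by (simp add: measure_pmf.emeasure_eq_measure)
qed

lemma prob_pair_pmf_le_given_snd:
  assumes "\<And>y. y \<in> set_pmf q \<Longrightarrow> measure_pmf.prob p {x. (x, y) \<in> S} \<le> c"
  shows "measure_pmf.prob (pair_pmf p q) S \<le> c"
proof -
  have "measure_pmf.prob (pair_pmf p q) S = measure_pmf.prob (pair_pmf q p) {(y, x). (x, y) \<in> S}"
    by (subst pair_commute_pmf) (simp add: vimage_def case_prod_unfold)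
  also have "\<dots> \<le> c" using assms by (intro prob_pair_pmf_le_given_fst) simp
  finally show ?thesis .
qed

lemma prob_pair_pmf_of_set:
  assumes "finite A" "A \<noteq> {}"
  shows "measure_pmf.prob (pair_pmf p (pmf_of_set A)) S
    = (\<Sum>a\<in>A. measure_pmf.prob p {x. (x, a) \<in> S}) / card A"
proof -
  have "card A > 0" using assms by (simp add: card_gt_0_iff)
  have "emeasure (pair_pmf p (pmf_of_set A)) S
      = (\<integral>\<^sup>+a. emeasure p {x. (x, a) \<in> S} \<partial>pmf_of_set A)"
    by (subst pair_commute_pmf, simp add: pair_pmf_def flip: map_pmf_def) (simp add: vimage_def)
  also have "\<dots> = ennreal ((\<Sum>a\<in>A. measure_pmf.prob p {x. (x, a) \<in> S}) / card A)"
    using assms \<open>card A > 0\<close>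
    by (simp add: nn_integral_pmf_of_set measure_pmf.emeasure_eq_measure sum_nonneg
        divide_ennreal[symmetric] ennreal_of_nat_eq_real_of_nat)
  finally show ?thesis by (simp add: measure_pmf.emeasure_eq_measure sum_nonneg)
qed

lemma pair_pmf_of_set:
  assumes "finite A" "A \<noteq> {}" "finite B" "B \<noteq> {}"
  shows "pair_pmf (pmf_of_set A) (pmf_of_set B) = pmf_of_set (A \<times> B)"
proof (rule pmf_eqI)
  fix x :: "'a \<times> 'b"
  show "pmf (pair_pmf (pmf_of_set A) (pmf_of_set B)) x = pmf (pmf_of_set (A \<times> B)) x"
    using assms by (cases x) (simp add: pmf_pair card_cartesian_product indicator_def)
qed

lemma symmetric_guess_error_ge:
  fixes p :: "'a pmf" and h :: "'a \<Rightarrow> 'b" and D :: "'a \<Rightarrow> 'a \<Rightarrow> 'b"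
  assumes fst: "\<And>y. measure_pmf.prob p {x. D x y \<noteq> h x} \<le> \<epsilon>"
    and snd: "\<And>x. measure_pmf.prob p {y. D x y \<noteq> h y} \<le> \<epsilon>"
    and label: "\<And>b. measure_pmf.prob p {x. h x = b} \<le> \<gamma>"
  shows "1 \<le> 2 * \<epsilon> + \<gamma>"
proof -
  let ?P = "measure_pmf.prob (pair_pmf p p)"
  have "1 = ?P UNIV" by simp
  also have "UNIV = {(x, y). D x y \<noteq> h x} \<union> {(x, y). D x y \<noteq> h y} \<union> {(x, y). h y = h x}" by auto
  also have "?P \<dots> \<le> ?P {(x, y). D x y \<noteq> h x} + ?P {(x, y). D x y \<noteq> h y} + ?P {(x, y). h y = h x}"
    by (intro order_trans[OF measure_Un_le] add_right_mono measure_Un_le) auto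
  also have "\<dots> \<le> \<epsilon> + \<epsilon> + \<gamma>"
    by (intro add_mono prob_pair_pmf_le_given_snd[where S = "{(x, y). D x y \<noteq> h x}"]
        prob_pair_pmf_le_given_fst) (simp_all add: fst snd label)
  finally show ?thesis by simp
qed

lemma prob_determined_coordinate_le:
  fixes W :: "'w pmf" and \<kappa> :: "'w \<Rightarrow> 'i \<Rightarrow> 'b"
  assumes uniform: "map_pmf \<kappa> W = pmf_of_set (Pi\<^sub>E I A)"
    and index: "finite I" "j \<in> I" and ranges: "\<And>i. i \<in> I \<Longrightarrow> finite (A i) \<and> A i \<noteq> {}"
    and determined: "\<And>x y. \<lbrakk>x \<in> S; y \<in> S; \<kappa> x \<in> Pi\<^sub>E I A; \<kappa> y \<in> Pi\<^sub>E I A; \<And>i. i \<noteq> j \<Longrightarrow> \<kappa> x i = \<kappa> y i\<rbrakk>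
      \<Longrightarrow> \<kappa> x j = \<kappa> y j"
  shows "measure_pmf.prob W S \<le> 1 / card (A j)"
proof -
  let ?F = "Pi\<^sub>E I A \<inter> \<kappa> ` S"
  have finite: "finite (Pi\<^sub>E I A)" using index ranges by (simp add: finite_PiE)
  have nonempty: "Pi\<^sub>E I A \<noteq> {}" using ranges by (simp add: PiE_eq_empty_iff)
  have "inj_on (\<lambda>(a, v). a(j := v)) (?F \<times> A j)"
  proof (rule inj_onI, clarify)
    fix x v y v'
    assume mem: "x \<in> S" "y \<in> S" "\<kappa> x \<in> Pi\<^sub>E I A" "\<kappa> y \<in> Pi\<^sub>E I A"
      and upd: "(\<kappa> x)(j := v) = (\<kappa> y)(j := v')"
    have off: "\<kappa> x i = \<kappa> y i" if "i \<noteq> j" for i using fun_cong[OF upd, of i] that by simp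
    then have "\<kappa> x j = \<kappa> y j" by (rule determined[OF mem])
    with off have "\<kappa> x = \<kappa> y" by (metis ext)
    moreover have "v = v'" using fun_cong[OF upd, of j] by simp
    ultimately show "\<kappa> x = \<kappa> y \<and> v = v'" by simp
  qed
  moreover have "(\<lambda>(a, v). a(j := v)) ` (?F \<times> A j) \<subseteq> Pi\<^sub>E I A"
    using index(2) by (auto simp: PiE_iff extensional_def)
  ultimately have "card (?F \<times> A j) \<le> card (Pi\<^sub>E I A)" using finite by (rule card_inj_on_le)
  then have count: "real (card ?F) * card (A j) \<le> card (Pi\<^sub>E I A)"
    by (simp add: card_cartesian_product flip: of_nat_mult)
  have "measure_pmf.prob W S \<le> measure_pmf.prob W (\<kappa> -` \<kappa> ` S)"
    by (intro measure_pmf.finite_measure_mono) auto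
  also have "\<dots> = card ?F / card (Pi\<^sub>E I A)"
    using finite nonempty by (simp add: uniform measure_pmf_of_set flip: measure_map_pmf)
  also have "\<dots> \<le> 1 / card (A j)"
    using count finite nonempty ranges[OF index(2)] by (simp add: field_simps card_gt_0_iff)
  finally show ?thesis .
qed

lemma prob_snd_pair_pmf_of_set_le:
  assumes "finite A" "A \<noteq> {}"
  shows "measure_pmf.prob (pair_pmf p (pmf_of_set A)) {x. snd x = a} \<le> 1 / card A"
proof -
  have "measure_pmf.prob (pair_pmf p (pmf_of_set A)) {x. snd x = a}
      = measure_pmf.prob (map_pmf snd (pair_pmf p (pmf_of_set A))) {a}"
    by (simp add: vimage_def)
  also have "\<dots> \<le> 1 / card A"
    using assms by (auto simp: map_snd_pair_pmf measure_pmf_of_set divide_right_mono Int_insert_right)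
  finally show ?thesis .
qed

lemma ex_nat_pmf_map_eq_pmf_of_set:
  assumes "finite A" "A \<noteq> {}"
  shows "\<exists>(W :: nat pmf) \<kappa>. map_pmf \<kappa> W = pmf_of_set A"
proof -
  obtain \<kappa> where "bij_betw \<kappa> {0..<card A} A" using ex_bij_betw_nat_finite[OF assms(1)] ..
  moreover have "{0..<card A} \<noteq> {}" using assms by simp
  ultimately have "map_pmf \<kappa> (pmf_of_set {0..<card A}) = pmf_of_set A"
    by (intro map_pmf_of_set_bij_betw) auto
  then show ?thesis by blast
qed

section \<open>The channel equation\<close>

lemma rstart_le: "rstart ns t \<le> t"
proof -
  let ?S = "{sum_list (take k ns) | k. k \<le> length ns \<and> sum_list (take k ns) \<le> t}"
  have "finite ?S" by (rule finite_subset[of _ "{..t}"]) auto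
  moreover have "sum_list (take 0 ns) \<in> ?S" by fastforce
  ultimately have "Max ?S \<in> ?S" by (intro Max_in) auto
  then show ?thesis unfolding rstart_def by auto
qed

lemma rstart_eqI:
  assumes "k < length ns" "sum_list (take k ns) \<le> t" "t < sum_list (take (Suc k) ns)"
  shows "rstart ns t = sum_list (take k ns)"
  unfolding rstart_def
proof (rule Max_eqI)
  let ?S = "{sum_list (take j ns) | j. j \<le> length ns \<and> sum_list (take j ns) \<le> t}"
  have mono: "sum_list (take i ns) \<le> sum_list (take j ns)" if "i \<le> j" for i j
    using that by (metis append_take_drop_id le_add1 min.absorb1 sum_list_append take_take)
  show "finite ?S" by (rule finite_subset[of _ "{..t}"]) auto
  show "sum_list (take k ns) \<in> ?S" using assms by auto
  show "x \<le> sum_list (take k ns)" if x: "x \<in> ?S" for x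
  proof -
    obtain j where x_eq: "x = sum_list (take j ns)" and "x \<le> t" using x by blast
    then have "\<not> Suc k \<le> j" using mono[of "Suc k" j] assms(3) by linarith
    then show ?thesis using mono x_eq by simp
  qed
qed

lemma xsym_less: "q > 0 \<Longrightarrow> xsym q enc ns m w Y s i < q"
  by (simp add: xsym_def)

lemma trunc_trunc: "s \<le> t \<Longrightarrow> trunc s (trunc t Y) = trunc s Y"
  by (auto simp: trunc_def fun_eq_iff)

lemma xsym_trunc: "s \<le> t \<Longrightarrow> xsym q enc ns m w (trunc t Y) s = xsym q enc ns m w Y s"
  using rstart_le[of ns s] by (simp add: xsym_def trunc_trunc fun_eq_iff)

definition noise :: "nat \<Rightarrow> encoder \<Rightarrow> nat list \<Rightarrow> nat set \<Rightarrow> nat set \<Rightarrow> jammer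
    \<Rightarrow> nat \<Rightarrow> nat \<Rightarrow> array \<Rightarrow> array" where
  "noise q enc ns Zr Zw adv m w Y t i = (if i \<in> Zw
     then adv t (\<lambda>s j. if s \<le> t \<and> j \<in> Zr then xsym q enc ns m w Y s j else 0) i else 0)"

lemma noise_cong:
  assumes "\<And>s j. s \<le> t \<Longrightarrow> j \<in> Zr \<Longrightarrow> xsym q enc ns m w Y s j = xsym q enc ns m' w' Y' s j"
  shows "noise q enc ns Zr Zw adv m w Y t = noise q enc ns Zr Zw adv m' w' Y' t"
proof -
  have "(\<lambda>s j. if s \<le> t \<and> j \<in> Zr then xsym q enc ns m w Y s j else 0)
      = (\<lambda>s j. if s \<le> t \<and> j \<in> Zr then xsym q enc ns m' w' Y' s j else 0)"
    using assms by (auto simp: fun_eq_iff)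
  then show ?thesis by (simp add: noise_def fun_eq_iff)
qed

lemma noise_trunc: "noise q enc ns Zr Zw adv m w (trunc t Y) t = noise q enc ns Zr Zw adv m w Y t"
  by (rule noise_cong) (simp add: xsym_trunc)

lemma run_Suc:
  "run q C enc ns Zr Zw adv m w (Suc t) = (\<lambda>s i. if s = t \<and> i < C
     then (xsym q enc ns m w (run q C enc ns Zr Zw adv m w t) t i
       + noise q enc ns Zr Zw adv m w (run q C enc ns Zr Zw adv m w t) t i) mod q
     else run q C enc ns Zr Zw adv m w t s i)"
  by (auto simp: noise_def Let_def fun_eq_iff)

declare run.simps(2) [simp del]

lemma run_outside: "s \<ge> t \<or> i \<ge> C \<Longrightarrow> run q C enc ns Zr Zw adv m w t s i = 0"
  by (induction t) (auto simp: run_Suc)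

text \<open>By causality the recursion defining \<^const>\<open>run\<close> amounts to a fixed-point equation for the
  whole received array.\<close>

lemma run_eqI:
  assumes inside: "\<And>s i. s < t \<Longrightarrow> i < C \<Longrightarrow>
      Y s i = (xsym q enc ns m w Y s i + noise q enc ns Zr Zw adv m w Y s i) mod q"
    and outside: "\<And>s i. s \<ge> t \<or> i \<ge> C \<Longrightarrow> Y s i = 0"
  shows "run q C enc ns Zr Zw adv m w t = Y"
proof -
  have "run q C enc ns Zr Zw adv m w s = trunc s Y" if "s \<le> t" for s
    using that
  proof (induction s)
    case 0
    show ?case by (simp add: trunc_def)
  next
    case (Suc s)
    then have IH: "run q C enc ns Zr Zw adv m w s = trunc s Y" and "s < t" by simp_all
    show ?case
      unfolding run_Suc IH noise_trunc xsym_trunc[OF order_refl] using inside \<open>s < t\<close> outside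
      by (auto simp: trunc_def fun_eq_iff less_Suc_eq)
  qed
  then have "run q C enc ns Zr Zw adv m w t = trunc t Y" by simp
  also have "\<dots> = Y" using outside by (auto simp: trunc_def fun_eq_iff)
  finally show ?thesis .
qed

lemma trunc_run:
  "k \<le> t \<Longrightarrow> trunc k (run q C enc ns Zr Zw adv m w t) = run q C enc ns Zr Zw adv m w k"
proof (induction t rule: dec_induct)
  case base
  show ?case using run_outside by (auto simp: trunc_def fun_eq_iff)
next
  case (step t)
  have "trunc k (run q C enc ns Zr Zw adv m w (Suc t)) = trunc k (run q C enc ns Zr Zw adv m w t)"
    using step.hyps by (auto simp: trunc_def fun_eq_iff run_Suc)
  then show ?case using step.IH by simp
qed

lemma run_inside:
  fixes q C :: nat and enc ns Zr Zw adv m w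
  assumes "s < t" "i < C"
  defines "Y \<equiv> run q C enc ns Zr Zw adv m w t"
  shows "Y s i = (xsym q enc ns m w Y s i + noise q enc ns Zr Zw adv m w Y s i) mod q"
proof -
  have prefix: "run q C enc ns Zr Zw adv m w u = trunc u Y" if "u \<le> t" for u
    using that by (simp add: Y_def trunc_run)
  have "Y s i = trunc (Suc s) Y s i" by (simp add: trunc_def)
  also have "\<dots> = run q C enc ns Zr Zw adv m w (Suc s) s i"
    using assms(1) by (simp only: prefix Suc_leI)
  also have "\<dots> = (xsym q enc ns m w (trunc s Y) s i
      + noise q enc ns Zr Zw adv m w (trunc s Y) s i) mod q"
    using assms(1,2) by (simp add: run_Suc prefix)
  also have "\<dots> = (xsym q enc ns m w Y s i + noise q enc ns Zr Zw adv m w Y s i) mod q"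
    by (simp add: xsym_trunc noise_trunc)
  finally show ?thesis .
qed

lemma run_less: "q > 0 \<Longrightarrow> run q C enc ns Zr Zw adv m w t s i < q"
  by (induction t) (auto simp: run_Suc)

section \<open>Reliable codes\<close>

definition has_reliable_code :: "nat \<Rightarrow> nat \<Rightarrow> nat \<Rightarrow> nat \<Rightarrow> nat \<Rightarrow> nat \<Rightarrow> nat \<Rightarrow> real \<Rightarrow> bool" where
  "has_reliable_code C zrw zro zwo n q K \<epsilon> \<longleftrightarrow>
     (\<exists>ns enc dec W. ns \<noteq> [] \<and> sum_list ns = n \<and>
       (\<forall>Zrw Zro Zwo adv. admissible_sets C zrw zro zwo Zrw Zro Zwo \<longrightarrow>
          err_prob q C n ns K enc dec W (Zrw \<union> Zro) (Zrw \<union> Zwo) adv < \<epsilon>))"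

lemma achievable_iff_has_reliable_code:
  "achievable C zrw zro zwo R \<longleftrightarrow> (\<forall>\<epsilon>>0. \<forall>\<^sub>F n in sequentially. \<exists>q\<ge>2.
     has_reliable_code C zrw zro zwo n q (nat \<lceil>real q powr (real n * R)\<rceil>) \<epsilon>)"
  by (simp add: achievable_def has_reliable_code_def eventually_sequentially)

lemma err_prob_eq_prob_pair_pmf:
  assumes "K > 0"
  shows "err_prob q C n ns K enc dec W Zr Zw adv
    = measure_pmf.prob (pair_pmf W (pmf_of_set {..<K}))
        {(w, m). dec (run q C enc ns Zr Zw adv m w n) \<noteq> m}"
  using assms by (subst prob_pair_pmf_of_set) (auto simp: err_prob_def)

lemma has_reliable_codeI:
  assumes "ns \<noteq> []" "sum_list ns = n" "K > 0" "c < \<epsilon>"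
    and error: "\<And>Zr Zw adv m. \<lbrakk>Zr \<subseteq> {..<C}; card Zr \<le> zrw + zro;
      Zw \<subseteq> {..<C}; card Zw \<le> zrw + zwo; m < K\<rbrakk>
      \<Longrightarrow> measure_pmf.prob W {w. dec (run q C enc ns Zr Zw adv m w n) \<noteq> m} \<le> c"
  shows "has_reliable_code C zrw zro zwo n q K \<epsilon>"
  unfolding has_reliable_code_def
proof (intro exI conjI allI impI)
  fix Zrw Zro Zwo adv
  assume adm: "admissible_sets C zrw zro zwo Zrw Zro Zwo"
  have "err_prob q C n ns K enc dec W (Zrw \<union> Zro) (Zrw \<union> Zwo) adv \<le> c"
    unfolding err_prob_eq_prob_pair_pmf[OF \<open>K > 0\<close>]
  proof (rule prob_pair_pmf_le_given_snd)
    fix m assume "m \<in> set_pmf (pmf_of_set {..<K})"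
    then have "m < K" using \<open>K > 0\<close> by (simp add: lessThan_empty_iff)
    moreover have "card (Zrw \<union> Zro) \<le> zrw + zro" "card (Zrw \<union> Zwo) \<le> zrw + zwo"
      "Zrw \<union> Zro \<subseteq> {..<C}" "Zrw \<union> Zwo \<subseteq> {..<C}"
      using adm card_Un_le[of Zrw Zro] card_Un_le[of Zrw Zwo] by (auto simp: admissible_sets_def)
    ultimately show "measure_pmf.prob W {w. (w, m) \<in> {(w, m). dec (run q C enc ns (Zrw \<union> Zro)
        (Zrw \<union> Zwo) adv m w n) \<noteq> m}} \<le> c"
      using error by simp
  qed
  then show "err_prob q C n ns K enc dec W (Zrw \<union> Zro) (Zrw \<union> Zwo) adv < \<epsilon>" using \<open>c < \<epsilon>\<close> by simp
qed fact+

lemma has_reliable_codeE: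
  assumes "has_reliable_code C zrw zro zwo n q K \<epsilon>" "K > 0"
  obtains ns enc dec W where "\<forall>Zrw Zro Zwo adv. admissible_sets C zrw zro zwo Zrw Zro Zwo \<longrightarrow>
    measure_pmf.prob (pair_pmf W (pmf_of_set {..<K}))
      {(w, m). dec (run q C enc ns (Zrw \<union> Zro) (Zrw \<union> Zwo) adv m w n) \<noteq> m} < \<epsilon>"
  using assms(1) unfolding has_reliable_code_def err_prob_eq_prob_pair_pmf[OF assms(2)] by blast

lemma achievable_obtains_reliable_code:
  assumes "achievable C zrw zro zwo R" "\<epsilon> > 0" "eventually P sequentially"
  obtains n q where "P n" "q \<ge> 2"
    "has_reliable_code C zrw zro zwo n q (nat \<lceil>real q powr (real n * R)\<rceil>) \<epsilon>"
proof -
  have "\<forall>\<^sub>F n in sequentially. P n \<and> (\<exists>q\<ge>2.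
      has_reliable_code C zrw zro zwo n q (nat \<lceil>real q powr (real n * R)\<rceil>) \<epsilon>)"
    using assms by (intro eventually_conj) (simp_all add: achievable_iff_has_reliable_code)
  then show thesis using that by (auto dest: eventually_happens)
qed

section \<open>Uniform noise\<close>

lemma noise_eq_if_run_eq:
  fixes q n :: nat and e e' :: "nat \<times> nat \<Rightarrow> nat"
  assumes "run q C enc ns Zr Zw (\<lambda>t _ i. e (t, i)) m w n
      = run q C enc ns Zr Zw (\<lambda>t _ i. e' (t, i)) m w n"
    and "t < n" "i < C" "i \<in> Zw" "e (t, i) < q" "e' (t, i) < q"
  shows "e (t, i) = e' (t, i)"
proof -
  define Y where "Y = run q C enc ns Zr Zw (\<lambda>t _ i. e (t, i)) m w n"
  let ?X = "xsym q enc ns m w Y t i"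
  have "[?X + e (t, i) = ?X + e' (t, i)] (mod q)"
    using run_inside[of t n i C q enc ns Zr Zw "\<lambda>t _ i. e (t, i)" m w]
      run_inside[of t n i C q enc ns Zr Zw "\<lambda>t _ i. e' (t, i)" m w] assms
    by (simp add: Y_def noise_def cong_def)
  then have "[e (t, i) = e' (t, i)] (mod q)" by (simp add: cong_add_lcancel_nat)
  then show ?thesis using assms(5,6) by (rule cong_less_modulus_unique_nat)
qed

text \<open>For fixed \<open>w\<close>, the received array determines a correctly decoded \<open>m\<close>, hence the sent symbols,
  hence the noise \<open>e\<close>.\<close>

lemma card_correct_message_noise_pairs_le:
  assumes "q > 0" "Zw \<subseteq> {..<C}"
  shows "card (({..<K} \<times> ({..<n} \<times> Zw \<rightarrow>\<^sub>E {..<q})) \<inter>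
      {(m, e). dec (run q C enc ns Zr Zw (\<lambda>t _ i. e (t, i)) m w n) = m}) \<le> q ^ (C * n)"
    (is "card ?G \<le> _")
proof -
  define Y where "Y = (\<lambda>(m, e). run q C enc ns Zr Zw (\<lambda>t _ i. e (t, i)) m w n)"
  define h where "h = (\<lambda>x. restrict (\<lambda>(s, i). Y x s i) ({..<n} \<times> {..<C}))"
  have "inj_on h ?G"
  proof (rule inj_onI, clarsimp)
    fix m e m' e'
    assume e: "e \<in> {..<n} \<times> Zw \<rightarrow>\<^sub>E {..<q}" "e' \<in> {..<n} \<times> Zw \<rightarrow>\<^sub>E {..<q}"
      and m: "dec (run q C enc ns Zr Zw (\<lambda>t _ i. e (t, i)) m w n) = m"
      and m': "dec (run q C enc ns Zr Zw (\<lambda>t _ i. e' (t, i)) m' w n) = m'"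
      and h: "h (m, e) = h (m', e')"
    have "Y (m, e) s i = Y (m', e') s i" if "s < n" "i < C" for s i
      using fun_cong[OF h, of "(s, i)"] that by (simp add: h_def)
    then have Y_eq: "Y (m, e) = Y (m', e')"
      unfolding Y_def fun_eq_iff using run_outside by (metis case_prod_conv not_le)
    then have "m = m'" using m m' by (simp add: Y_def)
    moreover have "e x = e' x" if x: "x \<in> {..<n} \<times> Zw" for x
    proof -
      obtain t i where "x = (t, i)" "t < n" "i \<in> Zw" "i < C" using x assms(2) by auto
      then show ?thesis
        using noise_eq_if_run_eq[OF Y_eq[unfolded Y_def \<open>m = m'\<close> prod.case]] e by (auto simp: PiE_iff)
    qed
    then have "e = e'" using e by (intro PiE_ext) auto
    ultimately show "m = m' \<and> e = e'" by simp
  qed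
  moreover have "h ` ?G \<subseteq> {..<n} \<times> {..<C} \<rightarrow>\<^sub>E {..<q}"
    using assms(1) by (auto simp: h_def Y_def run_less split: if_splits)
  moreover have "finite ({..<n} \<times> {..<C} \<rightarrow>\<^sub>E {..<q})" by (intro finite_PiE) auto
  ultimately have "card ?G \<le> card ({..<n} \<times> {..<C} \<rightarrow>\<^sub>E {..<q})" by (rule card_inj_on_le)
  also have "\<dots> = q ^ (C * n)" by (simp add: card_PiE card_cartesian_product mult.commute)
  finally show ?thesis .
qed

lemma prob_correct_under_uniform_noise_le:
  fixes W :: "nat pmf"
  assumes "q > 0" "K > 0" and Zw: "Zw \<subseteq> {..<C}"
  shows "measure_pmf.prob
      (pair_pmf (pair_pmf W (pmf_of_set {..<K})) (pmf_of_set ({..<n} \<times> Zw \<rightarrow>\<^sub>E {..<q})))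
      {((w, m), e). dec (run q C enc ns Zr Zw (\<lambda>t _ i. e (t, i)) m w n) = m}
    \<le> q ^ (C * n) / (K * q ^ (n * card Zw))"
    (is "measure_pmf.prob (pair_pmf (pair_pmf W ?U) (pmf_of_set ?E)) _ \<le> ?bound")
proof -
  define correct where
    "correct = (\<lambda>w m e. dec (run q C enc ns Zr Zw (\<lambda>t _ i. e (t, i)) m w n) = m)"
  have "finite Zw" using Zw finite_subset by blast
  then have noise_space: "finite ?E" "?E \<noteq> {}" "card ?E = q ^ (n * card Zw)"
    using \<open>q > 0\<close>
    by (auto simp: finite_PiE PiE_eq_empty_iff card_PiE card_cartesian_product lessThan_empty_iff)
  have "measure_pmf.prob (pair_pmf (pair_pmf W ?U) (pmf_of_set ?E)) {((w, m), e). correct w m e}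
      = measure_pmf.prob (pair_pmf W (pair_pmf ?U (pmf_of_set ?E))) {(w, m, e). correct w m e}"
    unfolding pair_pair_pmf by (simp add: vimage_def case_prod_unfold)
  also have "\<dots> \<le> ?bound"
  proof (rule prob_pair_pmf_le_given_fst)
    fix w
    have "card (({..<K} \<times> ?E) \<inter> {(m, e). correct w m e}) \<le> q ^ (C * n)"
      unfolding correct_def using \<open>q > 0\<close> Zw by (rule card_correct_message_noise_pairs_le)
    then show "measure_pmf.prob (pair_pmf ?U (pmf_of_set ?E))
        {y. (w, y) \<in> {(w, m, e). correct w m e}} \<le> ?bound"
      using noise_space \<open>K > 0\<close>
      by (simp add: pair_pmf_of_set measure_pmf_of_set lessThan_empty_iff card_cartesian_product
          divide_right_mono case_prod_unfold)
  qed
  finally show ?thesis unfolding correct_def .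
qed

lemma has_reliable_code_imp_message_count_le:
  assumes code: "has_reliable_code C zrw zro zwo n q K \<epsilon>" and z: "zrw + zwo \<le> C" and "q > 0" "K > 0"
  shows "(1 - \<epsilon>) * K \<le> real q ^ (n * (C - (zrw + zwo)))"
proof -
  let ?Zw = "{..<zrw + zwo}"
  obtain ns enc dec W where error: "\<forall>Zrw Zro Zwo adv. admissible_sets C zrw zro zwo Zrw Zro Zwo \<longrightarrow>
      measure_pmf.prob (pair_pmf W (pmf_of_set {..<K}))
        {(w, m). dec (run q C enc ns (Zrw \<union> Zro) (Zrw \<union> Zwo) adv m w n) \<noteq> m} < \<epsilon>"
    using code \<open>K > 0\<close> by (rule has_reliable_codeE)
  define est where "est = (\<lambda>w m e. dec (run q C enc ns {..<zrw} ?Zw (\<lambda>t _ i. e (t, i)) m w n))"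
  let ?P = "measure_pmf.prob
      (pair_pmf (pair_pmf W (pmf_of_set {..<K})) (pmf_of_set ({..<n} \<times> ?Zw \<rightarrow>\<^sub>E {..<q})))"
  have wrong: "?P {((w, m), e). est w m e \<noteq> m} \<le> \<epsilon>"
  proof (rule prob_pair_pmf_le_given_snd)
    fix e
    have "admissible_sets C zrw zro zwo {..<zrw} {} {zrw..<zrw + zwo}"
      using z by (auto simp: admissible_sets_def)
    moreover have "{..<zrw} \<union> {zrw..<zrw + zwo} = ?Zw" by auto
    ultimately show "measure_pmf.prob (pair_pmf W (pmf_of_set {..<K}))
        {x. (x, e) \<in> {((w, m), e). est w m e \<noteq> m}} \<le> \<epsilon>"
      using error[rule_format, of "{..<zrw}" "{}" "{zrw..<zrw + zwo}" "\<lambda>t _ i. e (t, i)"]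
      by (simp add: est_def case_prod_unfold)
  qed
  have correct: "?P {((w, m), e). est w m e = m} \<le> q ^ (C * n) / (K * q ^ (n * (zrw + zwo)))"
    using prob_correct_under_uniform_noise_le[of q K ?Zw C W n dec enc ns "{..<zrw}"] \<open>q > 0\<close> \<open>K > 0\<close> z
    by (simp add: est_def)
  have "1 = ?P UNIV" by simp
  also have "UNIV = {((w, m), e). est w m e \<noteq> m} \<union> {((w, m), e). est w m e = m}" by auto
  also have "?P \<dots> \<le> ?P {((w, m), e). est w m e \<noteq> m} + ?P {((w, m), e). est w m e = m}"
    by (rule measure_Un_le) auto
  finally have "1 - \<epsilon> \<le> q ^ (C * n) / (K * q ^ (n * (zrw + zwo)))" using wrong correct by linarith
  also have "C * n = n * (C - (zrw + zwo)) + n * (zrw + zwo)"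
    using z by (simp flip: add_mult_distrib2 add: mult.commute)
  finally show ?thesis using \<open>q > 0\<close> \<open>K > 0\<close> by (simp add: field_simps power_add)
qed

lemma achievable_le_unjammed:
  assumes z: "zrw + zwo \<le> C" and achievable: "achievable C zrw zro zwo R"
  shows "R \<le> real C - real (zrw + zwo)"
proof (rule ccontr)
  define k where "k = C - (zrw + zwo)"
  assume "\<not> ?thesis"
  then have "R > k" using z by (simp add: k_def)
  then have "\<forall>\<^sub>F n in sequentially. 1 < real n * (R - k)" by real_asymp
  then obtain n q where growth: "1 < real n * (R - k)" and "q \<ge> 2"
    and code: "has_reliable_code C zrw zro zwo n q (nat \<lceil>real q powr (real n * R)\<rceil>) (1 / 2)"
    by (rule achievable_obtains_reliable_code[OF achievable half_gt_zero[OF zero_less_one]])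
  let ?K = "nat \<lceil>real q powr (real n * R)\<rceil>"
  have "2 * real q ^ (n * k) \<le> real q powr real (n * k + 1)"
    using \<open>q \<ge> 2\<close> by (subst powr_realpow) auto
  also have "\<dots> < real q powr (real n * R)"
    using \<open>q \<ge> 2\<close> growth by (intro powr_less_mono) (auto simp: algebra_simps)
  also have "\<dots> \<le> ?K" by linarith
  also have "\<dots> \<le> 2 * real q ^ (n * k)"
    using has_reliable_code_imp_message_count_le[OF code z] \<open>q \<ge> 2\<close> by (simp add: k_def)
  finally show False by simp
qed

section \<open>Impersonation\<close>

text \<open>The received array is the same whether the sender on \<open>P\<close> is genuine and the other one simulated
  or conversely. The senders \<open>f\<close> and \<open>g\<close> carry their messages with them and nobody jams, so the last
  arguments of \<^const>\<open>run\<close> in \<open>spliced_run\<close> are dummies.\<close>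

definition splice :: "nat set \<Rightarrow> (array \<Rightarrow> array) \<Rightarrow> (array \<Rightarrow> array) \<Rightarrow> encoder" where
  "splice P f g m w Y s i = (if i \<in> P then f Y s i else g Y s i)"

definition spliced_run :: "nat \<Rightarrow> nat \<Rightarrow> nat list \<Rightarrow> nat set \<Rightarrow> (array \<Rightarrow> array) \<Rightarrow> (array \<Rightarrow> array)
    \<Rightarrow> nat \<Rightarrow> array" where
  "spliced_run q C ns P f g = run q C (splice P f g) ns {} {} (\<lambda>_ _ _. 0) 0 0"

lemma spliced_run_swap: "spliced_run q C ns P f g = spliced_run q C ns (- P) g f"
proof -
  have "splice P f g = splice (- P) g f" by (simp add: splice_def fun_eq_iff)
  then show ?thesis by (simp add: spliced_run_def)
qed

lemma spliced_run_outside: "s \<ge> t \<or> i \<ge> C \<Longrightarrow> spliced_run q C ns P f g t s i = 0"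
  by (simp add: spliced_run_def run_outside)

lemma spliced_run_inside:
  assumes "s < t" "i < C"
  shows "spliced_run q C ns P f g t s i
    = (if i \<in> P then f else g) (trunc (rstart ns s) (spliced_run q C ns P f g t)) s i mod q"
  using run_inside[OF assms, of q "splice P f g" ns "{}" "{}"]
  by (simp add: spliced_run_def noise_def xsym_def splice_def)

lemma spliced_run_eqI:
  assumes "\<And>s i. s < t \<Longrightarrow> i < C \<Longrightarrow> Y s i = (if i \<in> P then f else g) (trunc (rstart ns s) Y) s i mod q"
    and "\<And>s i. s \<ge> t \<or> i \<ge> C \<Longrightarrow> Y s i = 0"
  shows "spliced_run q C ns P f g t = Y"
  unfolding spliced_run_def
proof (rule run_eqI)
  show "Y s i = (xsym q (splice P f g) ns 0 0 Y s i
      + noise q (splice P f g) ns {} {} (\<lambda>_ _ _. 0) 0 0 Y s i) mod q" if "s < t" "i < C" for s i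
    using assms(1)[OF that] by (simp add: noise_def xsym_def splice_def)
qed (use assms(2) in simp)

text \<open>Calvin recovers the feedback from what he reads: on \<open>P\<close> it is the transmitted symbol, elsewhere
  his own substitute.\<close>

lemma spliced_run_observed:
  assumes "s \<le> n"
    and obs: "\<And>u j. u < s \<Longrightarrow> j < C \<Longrightarrow> j \<in> P \<Longrightarrow> obs u j = spliced_run q C ns P f g n u j"
  shows "spliced_run q C ns P (\<lambda>_. obs) g s = trunc s (spliced_run q C ns P f g n)"
proof (rule spliced_run_eqI)
  let ?Y = "spliced_run q C ns P f g n"
  fix u j
  assume uj: "u < s" "j < C"
  then have "trunc (rstart ns u) (trunc s ?Y) = trunc (rstart ns u) ?Y"
    using rstart_le[of ns u] by (intro trunc_trunc) simp
  moreover have "trunc s ?Y u j = ?Y u j" using uj by (simp add: trunc_def)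
  ultimately show "trunc s ?Y u j
      = (if j \<in> P then \<lambda>_. obs else g) (trunc (rstart ns u) (trunc s ?Y)) u j mod q"
    using uj assms(1) obs[of u j] spliced_run_inside[of u n j C q ns P f g] by simp
qed (auto simp: trunc_def spliced_run_outside)

definition impersonate :: "nat \<Rightarrow> nat \<Rightarrow> encoder \<Rightarrow> nat list \<Rightarrow> nat set \<Rightarrow> nat \<Rightarrow> nat \<Rightarrow> jammer" where
  "impersonate q C enc ns P m' w' t obs i = (if i \<in> P then 0 else
     xsym q enc ns m' w' (spliced_run q C ns P (\<lambda>_. obs) (enc m' w') t) t i + (q - obs t i))"

lemma run_impersonate:
  assumes "q > 0" and jammable: "{..<C} - P \<subseteq> Zw"
  shows "run q C enc ns {..<C} Zw (impersonate q C enc ns P m' w') m w n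
    = spliced_run q C ns P (enc m w) (enc m' w') n"
proof (rule run_eqI)
  let ?Y = "spliced_run q C ns P (enc m w) (enc m' w') n"
  have Y_eq: "?Y u j = (if j \<in> P then xsym q enc ns m w ?Y u j else xsym q enc ns m' w' ?Y u j)"
    if "u < n" "j < C" for u j
    using spliced_run_inside[OF that] by (simp add: xsym_def)
  fix s i
  assume "s < n" "i < C"
  define obs where "obs = (\<lambda>u j. if u \<le> s \<and> j \<in> {..<C} then xsym q enc ns m w ?Y u j else 0)"
  have feedback: "spliced_run q C ns P (\<lambda>_. obs) (enc m' w') s = trunc s ?Y"
    using \<open>s < n\<close> Y_eq by (intro spliced_run_observed) (auto simp: obs_def)
  let ?X = "xsym q enc ns m w ?Y s i" and ?X' = "xsym q enc ns m' w' ?Y s i"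
  have "?X < q" "?X' < q" using \<open>q > 0\<close> by (simp_all add: xsym_less)
  have "noise q enc ns {..<C} Zw (impersonate q C enc ns P m' w') m w ?Y s i
      = (if i \<in> Zw then impersonate q C enc ns P m' w' s obs i else 0)"
    by (simp add: noise_def obs_def)
  also have "\<dots> = (if i \<in> P then 0 else ?X' + (q - ?X))"
    using jammable \<open>i < C\<close> by (auto simp: impersonate_def feedback xsym_trunc) (simp add: obs_def)
  finally show "?Y s i
      = (?X + noise q enc ns {..<C} Zw (impersonate q C enc ns P m' w') m w ?Y s i) mod q"
    using Y_eq[OF \<open>s < n\<close> \<open>i < C\<close>] \<open>?X < q\<close> \<open>?X' < q\<close> by simp
qed (rule spliced_run_outside)

lemma has_reliable_code_imp_error_ge_if_symmetrizable:
  assumes code: "has_reliable_code C zrw zro zwo n q K \<epsilon>"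
    and z: "zrw + zro = C" "C \<le> 2 * zrw" and "q > 0" "K > 0"
  shows "1 \<le> 2 * \<epsilon> + 1 / K"
proof -
  obtain ns enc dec W where error: "\<forall>Zrw Zro Zwo adv. admissible_sets C zrw zro zwo Zrw Zro Zwo \<longrightarrow>
      measure_pmf.prob (pair_pmf W (pmf_of_set {..<K}))
        {(w, m). dec (run q C enc ns (Zrw \<union> Zro) (Zrw \<union> Zwo) adv m w n) \<noteq> m} < \<epsilon>"
    using code \<open>K > 0\<close> by (rule has_reliable_codeE)
  define P where "P = {..<C - zrw}"
  let ?p = "pair_pmf W (pmf_of_set {..<K})"
  define est where "est = (\<lambda>(w, m) (w', m'). dec (spliced_run q C ns P (enc m w) (enc m' w') n))"
  have error_le: "measure_pmf.prob ?p {(w, m). dec (run q C enc ns {..<C} Zw adv m w n) \<noteq> m} \<le> \<epsilon>"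
    if "Zw \<subseteq> {..<C}" "card Zw = zrw" for Zw adv
  proof -
    have "admissible_sets C zrw zro zwo Zw ({..<C} - Zw) {}"
      using that z(1) finite_subset[of Zw "{..<C}"] by (auto simp: admissible_sets_def card_Diff_subset)
    moreover have "Zw \<union> ({..<C} - Zw) = {..<C}" using that by auto
    ultimately show ?thesis
      using error[rule_format, of Zw "{..<C} - Zw" "{}" adv] by simp
  qed
  show ?thesis
  proof (rule symmetric_guess_error_ge)
    fix y :: "nat \<times> nat"
    obtain w' m' where y: "y = (w', m')" by (cases y)
    have "{..<C} - P \<subseteq> {C - zrw..<C}" "{C - zrw..<C} \<subseteq> {..<C}" by (auto simp: P_def)
    then show "measure_pmf.prob ?p {x. est x y \<noteq> snd x} \<le> \<epsilon>"
      using error_le[of "{C - zrw..<C}" "impersonate q C enc ns P m' w'"] z \<open>q > 0\<close>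
      by (simp add: run_impersonate est_def y case_prod_unfold)
  next
    fix x :: "nat \<times> nat"
    obtain w m where x: "x = (w, m)" by (cases x)
    have "{..<C} - (- P) \<subseteq> {..<zrw}" using z by (auto simp: P_def)
    then show "measure_pmf.prob ?p {y. est x y \<noteq> snd y} \<le> \<epsilon>"
      using error_le[of "{..<zrw}" "impersonate q C enc ns (- P) m w"] z \<open>q > 0\<close>
      by (simp add: run_impersonate est_def x case_prod_unfold spliced_run_swap[of q C ns P])
  next
    show "measure_pmf.prob ?p {x. snd x = b} \<le> 1 / K" for b
      using prob_snd_pair_pmf_of_set_le[of "{..<K}" W b] \<open>K > 0\<close> by (simp add: lessThan_empty_iff)
  qed
qed

lemma achievable_le_0_if_symmetrizable:
  assumes z: "zrw + zro = C" "C \<le> 2 * zrw" and achievable: "achievable C zrw zro zwo R"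
  shows "R \<le> 0"
proof (rule ccontr)
  assume "\<not> R \<le> 0"
  obtain n q where "n > 0" "q \<ge> 2"
    and code: "has_reliable_code C zrw zro zwo n q (nat \<lceil>real q powr (real n * R)\<rceil>) (1 / 8)"
    using eventually_gt_at_top[of 0]
    by (rule achievable_obtains_reliable_code[OF achievable, of "1 / 8", rotated]) simp_all
  define K where "K = nat \<lceil>real q powr (real n * R)\<rceil>"
  have "real q powr 0 < real q powr (real n * R)"
    using \<open>n > 0\<close> \<open>q \<ge> 2\<close> \<open>\<not> R \<le> 0\<close> by (intro powr_less_mono) auto
  then have "1 < real q powr (real n * R)" using \<open>q \<ge> 2\<close> by simp
  then have "2 \<le> K" unfolding K_def by linarith
  then have "1 / real K \<le> 1 / 2" by (simp add: field_simps)
  moreover have "1 \<le> 2 * (1 / 8) + 1 / real K"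
    using \<open>q \<ge> 2\<close> \<open>2 \<le> K\<close>
    by (intro has_reliable_code_imp_error_ge_if_symmetrizable[OF code[folded K_def] z]) simp_all
  ultimately show False by simp
qed

section \<open>Reed-Solomon codes\<close>

lemma const_poly_dvd_if_roots:
  fixes p :: "'a :: idom" and P :: "'a poly"
  assumes "prime_elem p" "finite S"
    and "\<And>x y. x \<in> S \<Longrightarrow> y \<in> S \<Longrightarrow> p dvd x - y \<Longrightarrow> x = y"
    and "\<And>x. x \<in> S \<Longrightarrow> p dvd poly P x"
    and "degree P < card S"
  shows "[:p:] dvd P"
  using assms(2-)
proof (induction S arbitrary: P rule: finite_induct)
  case empty
  then show ?case by simp
next
  case (insert x S)
  define Q where "Q = synthetic_div P x"
  have P_eq: "P = [:-x, 1:] * Q + [:poly P x:]"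
    unfolding Q_def by (rule synthetic_div_correct'[symmetric])
  have value_x: "p dvd poly P x" using insert.prems by simp
  have "[:p:] dvd Q"
  proof (cases "degree P = 0")
    case True
    then have "Q = 0" by (simp add: Q_def synthetic_div_eq_0_iff)
    then show ?thesis by simp
  next
    case False
    show ?thesis
    proof (rule insert.IH)
      show "degree Q < card S"
        using False insert.prems(3) insert.hyps by (simp add: Q_def degree_synthetic_div)
      show "p dvd poly Q y" if y: "y \<in> S" for y
      proof -
        have "poly P y = (y - x) * poly Q y + poly P x" by (subst P_eq) (simp add: algebra_simps)
        then have "p dvd (y - x) * poly Q y"
          using insert.prems(2)[of y] y value_x by (simp add: dvd_add_left_iff)
        moreover have "\<not> p dvd y - x" using insert.prems(1)[of y x] insert.hyps y by auto
        ultimately show ?thesis using \<open>prime_elem p\<close> by (simp add: prime_elem_dvd_mult_iff)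
      qed
    qed (rule insert.prems(1); simp)
  qed
  then have "[:p:] dvd [:-x, 1:] * Q + [:poly P x:]" using value_x by (intro dvd_add dvd_mult) simp_all
  with P_eq show ?case by simp
qed

definition mds_code :: "nat \<Rightarrow> nat \<Rightarrow> nat \<Rightarrow> nat \<Rightarrow> nat \<Rightarrow> (nat \<Rightarrow> array) \<Rightarrow> bool" where
  "mds_code q C k n K f \<longleftrightarrow> (\<forall>m s i. f m s i < q) \<and>
     (\<forall>m<K. \<forall>m'<K. \<forall>I\<subseteq>{..<C}. k \<le> card I \<longrightarrow> (\<forall>s<n. \<forall>i\<in>I. f m s i = f m' s i) \<longrightarrow> m = m')"

lemma coeffs_eq_if_values_cong:
  fixes a b :: "nat \<Rightarrow> nat"
  assumes "prime q" and points: "I \<subseteq> {..<q}" "k \<le> card I"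
    and digits: "\<And>j. j < k \<Longrightarrow> a j < q \<and> b j < q"
    and cong: "\<And>i. i \<in> I \<Longrightarrow> [(\<Sum>j<k. a j * i ^ j) = (\<Sum>j<k. b j * i ^ j)] (mod q)"
    and "l < k"
  shows "a l = b l"
proof -
  define D where "D = (\<Sum>j<k. monom (int (a j) - int (b j)) j)"
  have "finite I" using points(1) finite_subset by blast
  have "[:int q:] dvd D"
  proof (rule const_poly_dvd_if_roots[where S = "int ` I"])
    have "degree D < k" unfolding D_def
      using \<open>l < k\<close> by (intro degree_sum_less) (auto intro: le_less_trans[OF degree_monom_le])
    then show "degree D < card (int ` I)" using points(2) by (simp add: card_image)
    show "x = y" if "x \<in> int ` I" "y \<in> int ` I" "int q dvd x - y" for x y
    proof -
      obtain i i' where residues: "x = int i" "y = int i'" "i < q" "i' < q"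
        using \<open>x \<in> _\<close> \<open>y \<in> _\<close> points(1) by auto
      then have "[i = i'] (mod q)"
        using \<open>int q dvd x - y\<close> by (simp only: cong_int_iff[symmetric] cong_iff_dvd_diff)
      then show ?thesis using residues cong_less_modulus_unique_nat by blast
    qed
    show "int q dvd poly D x" if x: "x \<in> int ` I" for x
    proof -
      obtain i where "i \<in> I" and x_eq: "x = int i" using x by auto
      have "poly D x = int (\<Sum>j<k. a j * i ^ j) - int (\<Sum>j<k. b j * i ^ j)"
        by (simp add: D_def x_eq poly_sum poly_monom left_diff_distrib sum_subtractf)
      then show ?thesis using cong[OF \<open>i \<in> I\<close>] by (simp only: cong_int_iff[symmetric] cong_iff_dvd_diff)
    qed
  qed (use \<open>prime q\<close> \<open>finite I\<close> in simp_all)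
  then have "int q dvd coeff D l" by (simp add: const_poly_dvd_iff)
  moreover have "coeff D l = int (a l) - int (b l)" using \<open>l < k\<close> by (simp add: D_def coeff_sum)
  ultimately have "[a l = b l] (mod q)" by (simp only: cong_int_iff[symmetric] cong_iff_dvd_diff)
  then show ?thesis using digits[OF \<open>l < k\<close>] cong_less_modulus_unique_nat by blast
qed

lemma ex_mds_code:
  assumes "prime q" "C \<le> q" "K \<le> q ^ (k * n)"
  shows "\<exists>f. mds_code q C k n K f"
proof -
  let ?A = "{..<n} \<times> {..<k} \<rightarrow>\<^sub>E {..<q}"
  have "card {..<K} \<le> card ?A"
    using assms(3) by (simp add: card_PiE card_cartesian_product mult.commute)
  moreover have "finite ?A" by (intro finite_PiE) auto
  ultimately obtain \<phi> where digits: "\<phi> ` {..<K} \<subseteq> ?A" "inj_on \<phi> {..<K}"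
    using card_le_inj[of "{..<K}" ?A] by auto
  define f where "f = (\<lambda>m s i. (\<Sum>j<k. \<phi> m (s, j) * i ^ j) mod q)"
  have "m = m'" if m: "m < K" "m' < K" and points: "I \<subseteq> {..<C}" "k \<le> card I"
    and agree: "\<forall>s<n. \<forall>i\<in>I. f m s i = f m' s i" for m m' I
  proof -
    have digits_mem: "\<phi> m \<in> ?A" "\<phi> m' \<in> ?A" using digits(1) m by auto
    have "\<phi> m (s, l) = \<phi> m' (s, l)" if "s < n" "l < k" for s l
    proof (rule coeffs_eq_if_values_cong[where a = "\<lambda>j. \<phi> m (s, j)" and b = "\<lambda>j. \<phi> m' (s, j)"])
      show "\<phi> m (s, j) < q \<and> \<phi> m' (s, j) < q" if "j < k" for j
        using digits_mem[THEN PiE_mem, of "(s, j)"] \<open>s < n\<close> that by simp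
      show "[(\<Sum>j<k. \<phi> m (s, j) * i ^ j) = (\<Sum>j<k. \<phi> m' (s, j) * i ^ j)] (mod q)" if "i \<in> I" for i
        using agree \<open>s < n\<close> that by (simp add: f_def cong_def)
      show "I \<subseteq> {..<q}" using points(1) \<open>C \<le> q\<close> by auto
    qed fact+
    then have "\<phi> m = \<phi> m'" using digits_mem by (intro PiE_ext) auto
    then show ?thesis using m by (simp add: inj_on_eq_iff[OF digits(2)])
  qed
  moreover have "f m s i < q" for m s i using \<open>prime q\<close> by (simp add: f_def prime_gt_0_nat)
  ultimately have "mds_code q C k n K f" unfolding mds_code_def by simp
  then show ?thesis by blast
qed

section \<open>Reporting the jammed links\<close>

lemma set_encode_less:
  assumes "J \<subseteq> {..<n}"
  shows "set_encode J < 2 ^ n"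
proof -
  have "set_encode J \<le> (\<Sum>i<n. 2 ^ i)" unfolding set_encode_def using assms by (intro sum_mono2) auto
  also have "\<dots> < 2 ^ n" by (simp add: lessThan_def flip: mask_eq_sum_exp)
  finally show ?thesis .
qed

definition mismatch :: "nat \<Rightarrow> nat \<Rightarrow> array \<Rightarrow> array \<Rightarrow> nat set" where
  "mismatch C n X Y = {i. i < C \<and> (\<exists>s<n. Y s i \<noteq> X s i)}"

lemma mismatch_cong:
  "(\<And>s i. s < n \<Longrightarrow> Y s i = Y' s i) \<Longrightarrow> mismatch C n X Y = mismatch C n X Y'"
  by (auto simp: mismatch_def)

lemma mismatch_subset: "mismatch C n X Y \<subseteq> {..<C}"
  by (auto simp: mismatch_def)

lemma mds_code_eqI:
  assumes "mds_code q C k n K f" "m < K" "m' < K"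
    and "mismatch C n (f m) Y = mismatch C n (f m') Y" "card (mismatch C n (f m) Y) + k \<le> C"
  shows "m = m'"
proof -
  let ?I = "{..<C} - mismatch C n (f m) Y"
  have "k \<le> card ?I"
    using assms(5) finite_subset[OF mismatch_subset] by (simp add: card_Diff_subset mismatch_subset)
  moreover have "f m s i = f m' s i" if "s < n" "i \<in> ?I" for s i
  proof -
    have "Y s i = f m s i" using that by (auto simp: mismatch_def)
    moreover have "Y s i = f m' s i" using that unfolding assms(4) by (auto simp: mismatch_def)
    ultimately show ?thesis by simp
  qed
  ultimately show ?thesis using assms(1-3) unfolding mds_code_def by (meson Diff_subset)
qed

definition report_enc :: "nat \<Rightarrow> nat \<Rightarrow> nat \<Rightarrow> (nat \<Rightarrow> array) \<Rightarrow> (nat \<Rightarrow> nat \<times> nat \<Rightarrow> nat)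
    \<Rightarrow> (array \<Rightarrow> nat set \<Rightarrow> nat) \<Rightarrow> encoder" where
  "report_enc C n\<^sub>1 n\<^sub>2 f \<kappa> g m w Y s i =
     (if s < n\<^sub>1 then f m s i
      else if s < n\<^sub>1 + n\<^sub>2 then \<kappa> w (s - n\<^sub>1, i)
      else g Y (mismatch C n\<^sub>1 (f m) Y))"

definition report_dec :: "nat \<Rightarrow> nat \<Rightarrow> nat \<Rightarrow> (nat \<Rightarrow> array) \<Rightarrow> (array \<Rightarrow> nat set \<Rightarrow> bool)
    \<Rightarrow> array \<Rightarrow> nat" where
  "report_dec C n\<^sub>1 K f accepts Y = (SOME m. m < K \<and> accepts Y (mismatch C n\<^sub>1 (f m) Y))"

locale report_scheme =
  fixes q C k n\<^sub>1 n\<^sub>2 K :: nat and f :: "nat \<Rightarrow> array" and \<kappa> :: "nat \<Rightarrow> nat \<times> nat \<Rightarrow> nat"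
    and g :: "array \<Rightarrow> nat set \<Rightarrow> nat" and Zr Zw :: "nat set" and adv :: jammer and m :: nat
  assumes mds: "mds_code q C k n\<^sub>1 K f" and message: "m < K"
    and g_less: "\<And>Y J. J \<subseteq> {..<C} \<Longrightarrow> g Y J < q"
    and Zw: "Zw \<subseteq> {..<C}" "card Zw + k \<le> C"
begin

abbreviation "N \<equiv> n\<^sub>1 + n\<^sub>2"
abbreviation "enc \<equiv> report_enc C n\<^sub>1 n\<^sub>2 f \<kappa> g"
abbreviation "received w \<equiv> run q C enc [N, Suc 0] Zr Zw adv m w (Suc N)"
abbreviation "sent w \<equiv> xsym q enc [N, Suc 0] m w (received w)"
abbreviation "jam w \<equiv> noise q enc [N, Suc 0] Zr Zw adv m w (received w)"
abbreviation "jammed w \<equiv> mismatch C n\<^sub>1 (f m) (received w)"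

lemma f_less: "f m s i < q"
  using mds by (simp add: mds_code_def)

lemma q_pos: "q > 0"
  using f_less by (rule le_less_trans[rotated]) simp

lemma finite_Zw: "finite Zw"
  using Zw(1) finite_subset by blast

lemma received_inside: "s \<le> N \<Longrightarrow> i < C \<Longrightarrow> received w s i = (sent w s i + jam w s i) mod q"
  by (rule run_inside) simp

lemma received_unjammed: "s \<le> N \<Longrightarrow> i < C \<Longrightarrow> i \<notin> Zw \<Longrightarrow> received w s i = sent w s i"
  by (simp add: received_inside noise_def xsym_less q_pos)

lemma sent_payload: "s < n\<^sub>1 \<Longrightarrow> sent w s i = f m s i"
  by (simp add: xsym_def report_enc_def f_less)

lemma sent_key: "d < n\<^sub>2 \<Longrightarrow> sent w (n\<^sub>1 + d) i = \<kappa> w (d, i) mod q"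
  by (simp add: xsym_def report_enc_def)

lemma sent_report: "sent w N i = g (trunc N (received w)) (jammed w)"
proof -
  have "rstart [N, Suc 0] N = N" using rstart_eqI[of 1 "[N, Suc 0]" N] by simp
  moreover have "mismatch C n\<^sub>1 (f m) (trunc N (received w)) = jammed w"
    by (rule mismatch_cong) (simp add: trunc_def)
  ultimately show ?thesis
    by (simp add: xsym_def report_enc_def g_less mismatch_subset)
qed

lemma jammed_subset: "jammed w \<subseteq> Zw"
proof
  fix i assume "i \<in> jammed w"
  then obtain s where "i < C" "s < n\<^sub>1" "received w s i \<noteq> f m s i" unfolding mismatch_def by blast
  then show "i \<in> Zw" using received_unjammed[of s i w] sent_payload[of s w i] by fastforce
qed

lemma report_dec_eq:
  assumes "accepts (received w) (jammed w)"
    and "\<And>J. J \<subseteq> {..<C} \<Longrightarrow> accepts (received w) J \<Longrightarrow> J = jammed w"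
  shows "report_dec C n\<^sub>1 K f accepts (received w) = m"
  unfolding report_dec_def
proof (rule some_equality)
  have "card (jammed w) + k \<le> C" using card_mono[OF finite_Zw jammed_subset[of w]] Zw(2) by linarith
  then show "m' = m" if "m' < K \<and> accepts (received w) (mismatch C n\<^sub>1 (f m') (received w))" for m'
    using mds_code_eqI[OF mds message] assms(2)[OF mismatch_subset] that by metis
qed (use assms(1) message in simp)

end

subsection \<open>Majority vote\<close>

definition majority_accepts :: "nat \<Rightarrow> nat \<Rightarrow> array \<Rightarrow> nat set \<Rightarrow> bool" where
  "majority_accepts C t Y J \<longleftrightarrow> C < 2 * card {i. i < C \<and> Y t i = set_encode J}"

lemma majority_unique:
  assumes "C < 2 * card {i. i < C \<and> y i = a}" "C < 2 * card {i. i < C \<and> y i = b}"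
  shows "a = b"
proof (rule ccontr)
  assume "a \<noteq> b"
  then have "card {i. i < C \<and> y i = a} + card {i. i < C \<and> y i = b}
      = card ({i. i < C \<and> y i = a} \<union> {i. i < C \<and> y i = b})"
    by (intro card_Un_disjoint[symmetric]) auto
  also have "\<dots> \<le> card {..<C}" by (intro card_mono) auto
  finally show False using assms by simp
qed

lemma majority_report_dec_eq:
  assumes "mds_code q C k n\<^sub>1 K f" "m < K" "2 ^ C \<le> q" "C < 2 * k" "Zw \<subseteq> {..<C}" "card Zw + k \<le> C"
  shows "report_dec C n\<^sub>1 K f (majority_accepts C (n\<^sub>1 + n\<^sub>2))
    (run q C (report_enc C n\<^sub>1 n\<^sub>2 f \<kappa> (\<lambda>_. set_encode)) [n\<^sub>1 + n\<^sub>2, Suc 0] Zr Zw adv m w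
      (Suc (n\<^sub>1 + n\<^sub>2))) = m"
proof -
  interpret report_scheme q C k n\<^sub>1 n\<^sub>2 K f \<kappa> "\<lambda>_. set_encode" Zr Zw adv m
    using assms set_encode_less by unfold_locales (auto intro: less_le_trans)
  show ?thesis
  proof (rule report_dec_eq)
    have "k \<le> card ({..<C} - Zw)"
      using Zw finite_Zw by (simp add: card_Diff_subset)
    also have "\<dots> \<le> card {i. i < C \<and> received w N i = set_encode (jammed w)}"
      using received_unjammed[of N] sent_report by (intro card_mono) auto
    finally show accepted: "majority_accepts C N (received w) (jammed w)"
      using \<open>C < 2 * k\<close> by (simp add: majority_accepts_def)
    show "J = jammed w" if "J \<subseteq> {..<C}" "majority_accepts C N (received w) J" for J
    proof -
      have "set_encode J = set_encode (jammed w)"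
        using that(2) accepted unfolding majority_accepts_def by (rule majority_unique)
      moreover have "finite J" "finite (jammed w)"
        using that(1) mismatch_subset finite_subset[of _ "{..<C}"] by auto
      ultimately show ?thesis by (simp add: set_encode_eq)
    qed
  qed
qed

subsection \<open>Keys shared through the feedback\<close>

definition link_sum_key :: "nat \<Rightarrow> nat \<Rightarrow> nat \<Rightarrow> array \<Rightarrow> nat set \<Rightarrow> nat" where
  "link_sum_key q C n\<^sub>1 Y J = (\<Sum>i<C. Y (n\<^sub>1 + set_encode J) i) mod q"

definition key_accepts :: "nat \<Rightarrow> nat \<Rightarrow> nat \<Rightarrow> nat \<Rightarrow> array \<Rightarrow> nat set \<Rightarrow> bool" where
  "key_accepts q C n\<^sub>1 t Y J \<longleftrightarrow> (\<exists>i<C. Y t i = link_sum_key q C n\<^sub>1 Y J)"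

locale key_report_scheme = report_scheme q C k n\<^sub>1 "2 ^ C" K f \<kappa> "link_sum_key q C n\<^sub>1" Zr Zw adv m
  for q C k n\<^sub>1 K f \<kappa> Zr Zw adv m
begin

lemma sent_report_key: "sent w N i = link_sum_key q C n\<^sub>1 (received w) (jammed w)"
  using set_encode_less[OF mismatch_subset]
  by (simp add: sent_report link_sum_key_def trunc_def)

text \<open>Changing a key symbol on a link that is not read changes nothing that Calvin sees before
  the last round, and nothing at all that he sees if the reported key is a different one.\<close>

context
  fixes x y d b :: nat
  assumes unread: "b < C" "b \<notin> Zr" and Zr: "Zr \<subseteq> {..<C}" and d: "d < 2 ^ C"
    and keys_eq: "\<And>l. l \<noteq> (d, b) \<Longrightarrow> \<kappa> x l = \<kappa> y l"
begin

lemma sent_unchanged: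
  assumes "s < N" "(s, i) \<noteq> (n\<^sub>1 + d, b)"
  shows "sent x s i = sent y s i"
proof (cases "s < n\<^sub>1")
  case True
  then show ?thesis by (simp only: sent_payload)
next
  case False
  then obtain e where e: "s = n\<^sub>1 + e" "e < 2 ^ C"
    using assms(1) by (metis add_less_cancel_left le_iff_add not_less)
  then show ?thesis using keys_eq[of "(e, i)"] assms(2) by (simp only: sent_key) simp
qed

lemma jam_unchanged: "s < N \<Longrightarrow> jam x s = jam y s"
  using unread by (intro noise_cong sent_unchanged) auto

lemma received_unchanged:
  assumes "s < N" "(s, i) \<noteq> (n\<^sub>1 + d, b)"
  shows "received x s i = received y s i"
proof (cases "i < C")
  case True
  then show ?thesis using assms sent_unchanged jam_unchanged by (simp add: received_inside)
next
  case False
  then show ?thesis by (simp add: run_outside)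
qed

lemma jammed_unchanged: "jammed x = jammed y"
  using received_unchanged by (intro mismatch_cong) simp

lemma report_row_unchanged:
  assumes "set_encode (jammed x) \<noteq> d" "i < C"
  shows "received x N i = received y N i"
proof -
  have "received x (n\<^sub>1 + set_encode (jammed x)) j = received y (n\<^sub>1 + set_encode (jammed x)) j" for j
    using assms(1) set_encode_less[OF mismatch_subset] by (intro received_unchanged) auto
  then have report_eq: "sent x N = sent y N"
    by (simp add: fun_eq_iff sent_report_key link_sum_key_def jammed_unchanged)
  have "sent x s j = sent y s j" if "s \<le> N" "j \<in> Zr" for s j
  proof (cases "s = N")
    case True
    then show ?thesis using report_eq by (simp only:)
  next
    case False
    then show ?thesis using that unread by (intro sent_unchanged) auto
  qed
  then have "jam x N = jam y N" by (rule noise_cong)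
  then show ?thesis using report_eq \<open>i < C\<close> by (simp only: received_inside order_refl)
qed

lemma key_symbol_eq_if_forged:
  assumes "\<kappa> x (d, b) < q" "\<kappa> y (d, b) < q" and J: "set_encode J = d" "jammed x \<noteq> J" "J \<subseteq> {..<C}"
    and "i < C" and forged: "received x N i = link_sum_key q C n\<^sub>1 (received x) J"
      "received y N i = link_sum_key q C n\<^sub>1 (received y) J"
  shows "\<kappa> x (d, b) = \<kappa> y (d, b)"
proof -
  have "set_encode (jammed x) \<noteq> d"
    using J set_encode_eq[of "jammed x" J] finite_subset[OF mismatch_subset]
      finite_subset[of J "{..<C}"] by auto
  then have "received x N i = received y N i" using \<open>i < C\<close> by (rule report_row_unchanged)
  then have "[(\<Sum>j<C. received x (n\<^sub>1 + d) j) = (\<Sum>j<C. received y (n\<^sub>1 + d) j)] (mod q)"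
    using forged by (simp add: link_sum_key_def J(1) cong_def)
  moreover have "(\<Sum>j\<in>{..<C} - {b}. received x (n\<^sub>1 + d) j) = (\<Sum>j\<in>{..<C} - {b}. received y (n\<^sub>1 + d) j)"
    using d by (intro sum.cong refl received_unchanged) auto
  ultimately have "[received x (n\<^sub>1 + d) b = received y (n\<^sub>1 + d) b] (mod q)"
    using unread(1) by (simp add: sum.remove[of "{..<C}" b] cong_add_rcancel_nat)
  then have "[sent x (n\<^sub>1 + d) b = sent y (n\<^sub>1 + d) b] (mod q)"
    using unread(1) d jam_unchanged[of "n\<^sub>1 + d"] by (simp add: received_inside cong_add_rcancel_nat)
  then have "[\<kappa> x (d, b) = \<kappa> y (d, b)] (mod q)" using d by (simp add: sent_key)
  then show ?thesis using assms(1,2) cong_less_modulus_unique_nat by blast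
qed

end

definition forged :: "nat set \<Rightarrow> nat \<Rightarrow> nat set" where
  "forged J i = {w. jammed w \<noteq> J \<and> received w N i = link_sum_key q C n\<^sub>1 (received w) J}"

lemma prob_forged_le:
  assumes uniform: "map_pmf \<kappa> W = pmf_of_set ({..<2 ^ C} \<times> {..<C} \<rightarrow>\<^sub>E {..<q})"
    and "Zr \<subset> {..<C}" and J: "J \<subseteq> {..<C}" and "i < C"
  shows "measure_pmf.prob W (forged J i) \<le> 1 / q"
proof -
  obtain b where unread: "b < C" "b \<notin> Zr" using \<open>Zr \<subset> {..<C}\<close> by blast
  let ?l = "(set_encode J, b)" and ?keys = "{..<2 ^ C} \<times> {..<C} \<rightarrow>\<^sub>E {..<q}"
  have position: "?l \<in> {..<2 ^ C} \<times> {..<C}" using set_encode_less[OF J] unread by simp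
  have "measure_pmf.prob W (forged J i) \<le> 1 / card {..<q}"
  proof (rule prob_determined_coordinate_le[OF uniform _ position])
    fix x y
    assume forged: "x \<in> forged J i" "y \<in> forged J i" and "\<kappa> x \<in> ?keys" "\<kappa> y \<in> ?keys"
      and keys_eq: "\<And>l. l \<noteq> ?l \<Longrightarrow> \<kappa> x l = \<kappa> y l"
    then have key_less: "\<kappa> x ?l < q" "\<kappa> y ?l < q" using position by (auto simp: PiE_iff)
    show "\<kappa> x ?l = \<kappa> y ?l"
    proof (rule key_symbol_eq_if_forged[where J = J and i = i])
      show "\<kappa> x l = \<kappa> y l" if "l \<noteq> ?l" for l using that by (rule keys_eq)
    qed (use unread \<open>Zr \<subset> {..<C}\<close> position key_less J \<open>i < C\<close> forged in \<open>auto simp: forged_def\<close>)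
  qed (use q_pos in auto)
  then show ?thesis by simp
qed

lemma key_report_dec_eq:
  assumes "k > 0" and unforged: "\<And>J i. J \<subseteq> {..<C} \<Longrightarrow> i < C \<Longrightarrow> w \<notin> forged J i"
  shows "report_dec C n\<^sub>1 K f (key_accepts q C n\<^sub>1 N) (received w) = m"
proof (rule report_dec_eq)
  have "\<not> {..<C} \<subseteq> Zw" using card_mono[OF finite_Zw, of "{..<C}"] Zw(2) \<open>k > 0\<close> by auto
  then obtain i where "i < C" "i \<notin> Zw" by blast
  then have "received w N i = link_sum_key q C n\<^sub>1 (received w) (jammed w)"
    by (simp add: received_unjammed sent_report_key)
  then show "key_accepts q C n\<^sub>1 N (received w) (jammed w)"
    using \<open>i < C\<close> unfolding key_accepts_def by blast
next
  fix J assume "J \<subseteq> {..<C}" "key_accepts q C n\<^sub>1 N (received w) J"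
  then show "J = jammed w" using unforged unfolding key_accepts_def forged_def by blast
qed

lemma prob_key_report_dec_error_le:
  assumes uniform: "map_pmf \<kappa> W = pmf_of_set ({..<2 ^ C} \<times> {..<C} \<rightarrow>\<^sub>E {..<q})"
    and Zr: "Zr \<subset> {..<C}" and "k > 0"
  shows "measure_pmf.prob W {w. report_dec C n\<^sub>1 K f (key_accepts q C n\<^sub>1 N) (received w) \<noteq> m}
    \<le> 2 ^ C * C / q"
proof -
  let ?I = "Pow {..<C} \<times> {..<C}"
  have "{w. report_dec C n\<^sub>1 K f (key_accepts q C n\<^sub>1 N) (received w) \<noteq> m} \<subseteq> (\<Union>(J, i)\<in>?I. forged J i)"
    using key_report_dec_eq[OF \<open>k > 0\<close>] by blast
  then have "measure_pmf.prob W {w. report_dec C n\<^sub>1 K f (key_accepts q C n\<^sub>1 N) (received w) \<noteq> m}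
      \<le> measure_pmf.prob W (\<Union>(J, i)\<in>?I. forged J i)"
    by (rule measure_pmf.finite_measure_mono) simp
  also have "\<dots> \<le> (\<Sum>(J, i)\<in>?I. measure_pmf.prob W (forged J i))"
    unfolding case_prod_unfold by (rule measure_UNION_le) auto
  also have "\<dots> \<le> (\<Sum>x\<in>?I. 1 / q)"
    using prob_forged_le[OF uniform Zr] by (intro sum_mono) auto
  also have "\<dots> = 2 ^ C * C / q" by (simp add: card_cartesian_product card_Pow)
  finally show ?thesis .
qed

end

section \<open>Capacity\<close>

lemma achievable_nonpos:
  assumes "R \<le> 0"
  shows "achievable C zrw zro zwo R"
  unfolding achievable_iff_has_reliable_code
proof (intro allI impI always_eventually exI[of _ 2] conjI)
  fix \<epsilon> :: real and n :: nat assume "\<epsilon> > 0"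
  have "real 2 powr (real n * R) \<le> 1"
    using assms powr_mono[of "real n * R" 0 2] by (simp add: mult_nonneg_nonpos)
  moreover have "real 2 powr (real n * R) > 0" by simp
  ultimately have "nat \<lceil>real 2 powr (real n * R)\<rceil> = 1" by linarith
  moreover have "has_reliable_code C zrw zro zwo n 2 1 \<epsilon>"
    by (rule has_reliable_codeI[where ns = "[n]" and c = 0 and dec = "\<lambda>_. 0"]) (use \<open>\<epsilon> > 0\<close> in auto)
  ultimately show "has_reliable_code C zrw zro zwo n 2 (nat \<lceil>real 2 powr (real n * R)\<rceil>) \<epsilon>" by simp
qed simp

lemma has_reliable_code_majority:
  assumes "prime q" "2 ^ C \<le> q" "K > 0" "K \<le> q ^ (k * n\<^sub>1)" "zrw + zwo + k \<le> C" "C < 2 * k" "\<epsilon> > 0"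
  shows "has_reliable_code C zrw zro zwo (Suc (n\<^sub>1 + n\<^sub>2)) q K \<epsilon>"
proof -
  have "C \<le> q" using less_exp[of C] \<open>2 ^ C \<le> q\<close> by linarith
  then obtain f where "mds_code q C k n\<^sub>1 K f" using assms(1,4) ex_mds_code by blast
  then show ?thesis
    using assms
    by (intro has_reliable_codeI[where ns = "[n\<^sub>1 + n\<^sub>2, Suc 0]" and c = 0 and W = "return_pmf 0"
        and enc = "report_enc C n\<^sub>1 n\<^sub>2 f (\<lambda>_ _. 0) (\<lambda>_. set_encode)"
        and dec = "report_dec C n\<^sub>1 K f (majority_accepts C (n\<^sub>1 + n\<^sub>2))"])
      (simp_all add: majority_report_dec_eq)
qed

lemma has_reliable_code_keys:
  assumes "prime q" "C \<le> q" "K > 0" "K \<le> q ^ (k * n\<^sub>1)" "zrw + zwo + k \<le> C" "k > 0"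
    and "zrw + zro < C" "2 ^ C * C / q < \<epsilon>"
  shows "has_reliable_code C zrw zro zwo (Suc (n\<^sub>1 + 2 ^ C)) q K \<epsilon>"
proof -
  obtain f where f: "mds_code q C k n\<^sub>1 K f" using assms(1,2,4) ex_mds_code by blast
  have "q > 0" using \<open>prime q\<close> by (rule prime_gt_0_nat)
  define keys where "keys = {..<2 ^ C :: nat} \<times> {..<C} \<rightarrow>\<^sub>E {..<q}"
  have "finite keys" "keys \<noteq> {}"
    using \<open>q > 0\<close> by (auto simp: keys_def finite_PiE PiE_eq_empty_iff lessThan_empty_iff)
  then obtain W :: "nat pmf" and \<kappa> where uniform: "map_pmf \<kappa> W = pmf_of_set keys"
    using ex_nat_pmf_map_eq_pmf_of_set[of keys] by auto
  show ?thesis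
  proof (rule has_reliable_codeI[where ns = "[n\<^sub>1 + 2 ^ C, Suc 0]"])
    fix Zr Zw adv m
    assume sets: "Zr \<subseteq> {..<C}" "card Zr \<le> zrw + zro" "Zw \<subseteq> {..<C}" "card Zw \<le> zrw + zwo" and "m < K"
    interpret key_report_scheme q C k n\<^sub>1 K f \<kappa> Zr Zw adv m
      using f sets \<open>m < K\<close> \<open>q > 0\<close> assms(5) by unfold_locales (auto simp: link_sum_key_def)
    have "Zr \<subset> {..<C}" using sets(1,2) \<open>zrw + zro < C\<close> by auto
    then show "measure_pmf.prob W {w. report_dec C n\<^sub>1 K f (key_accepts q C n\<^sub>1 N)
        (run q C enc [N, Suc 0] Zr Zw adv m w (Suc N)) \<noteq> m} \<le> 2 ^ C * C / q"
      using uniform \<open>k > 0\<close> unfolding keys_def by (intro prob_key_report_dec_error_le)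
  qed (use assms in simp_all)
qed

lemma nat_ceiling_powr_le_power:
  fixes q :: nat
  assumes "q > 0" "x \<le> real j"
  shows "nat \<lceil>real q powr x\<rceil> \<le> q ^ j"
proof -
  have "real q powr x \<le> real q powr real j" using assms by (intro powr_mono) auto
  also have "\<dots> = real (q ^ j)" using assms(1) by (subst powr_realpow) auto
  finally show ?thesis by linarith
qed

lemma achievable_below_unjammed:
  assumes not_sym: "zrw + zro < C \<or> 2 * (zrw + zwo) < C" and R: "R < real C - real (zrw + zwo)"
  shows "achievable C zrw zro zwo R"
proof (cases "R \<le> 0")
  case True
  then show ?thesis by (rule achievable_nonpos)
next
  case False
  define k where "k = C - (zrw + zwo)"
  have dimension: "zrw + zwo + k \<le> C" "k > 0" "R < k" using R False by (auto simp: k_def)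
  show ?thesis
    unfolding achievable_iff_has_reliable_code
  proof (intro allI impI)
    fix \<epsilon> :: real assume "\<epsilon> > 0"
    obtain q where q: "prime q" "q > max (2 ^ C) (nat \<lceil>2 ^ C * C / \<epsilon>\<rceil>)" using bigger_prime by blast
    then have "q \<ge> 2" "2 ^ C \<le> q" by (auto simp: prime_ge_2_nat)
    then have "C \<le> q" using less_exp[of C] by linarith
    have "2 ^ C * C / \<epsilon> < q" using q(2) by linarith
    then have error: "2 ^ C * C / q < \<epsilon>" using \<open>\<epsilon> > 0\<close> \<open>q \<ge> 2\<close> by (simp add: field_simps)
    have "\<forall>\<^sub>F n in sequentially. k * (2 ^ C + 1) \<le> real n * (k - R)" using dimension(3) by real_asymp
    then show "\<forall>\<^sub>F n in sequentially. \<exists>q\<ge>2.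
        has_reliable_code C zrw zro zwo n q (nat \<lceil>real q powr (real n * R)\<rceil>) \<epsilon>"
      using eventually_gt_at_top[of "2 ^ C"]
    proof eventually_elim
      case (elim n)
      define n\<^sub>1 where "n\<^sub>1 = n - Suc (2 ^ C)"
      have n_eq: "n = Suc (n\<^sub>1 + 2 ^ C)" using elim(2) by (simp add: n\<^sub>1_def)
      let ?K = "nat \<lceil>real q powr (real n * R)\<rceil>"
      have "real n * R \<le> real (k * n\<^sub>1)" using elim(1) by (simp add: n_eq algebra_simps)
      then have count: "?K \<le> q ^ (k * n\<^sub>1)" using \<open>q \<ge> 2\<close> by (intro nat_ceiling_powr_le_power) simp_all
      have "?K > 0" using \<open>q \<ge> 2\<close> by simp
      then have "has_reliable_code C zrw zro zwo n q ?K \<epsilon>"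
        using not_sym has_reliable_code_keys[OF q(1) \<open>C \<le> q\<close> _ count dimension(1,2) _ error]
          has_reliable_code_majority[OF q(1) \<open>2 ^ C \<le> q\<close> _ count dimension(1) _ \<open>\<epsilon> > 0\<close>]
        by (auto simp: n_eq k_def)
      then show ?case using \<open>q \<ge> 2\<close> by blast
    qed
  qed
qed

theorem theorem7:
  fixes C zrw zro zwo :: nat
  assumes "zrw + zro + zwo \<le> C"
  shows "capacity C zrw zro zwo =
    (if zrw + zro = C \<and> C \<le> 2 * (zrw + zwo) then 0 else real C - real (zrw + zwo))"
proof (cases "zrw + zro = C \<and> C \<le> 2 * (zrw + zwo)")
  case True
  then have "R \<le> 0" if "achievable C zrw zro zwo R" for R
    using that assms by (intro achievable_le_0_if_symmetrizable[of zrw zro C zwo R]) auto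
  then have "{R. achievable C zrw zro zwo R} = {..0}" using achievable_nonpos by auto
  then show ?thesis using True by (simp add: capacity_def)
next
  case False
  let ?k = "real C - real (zrw + zwo)"
  have "Sup {R. achievable C zrw zro zwo R} = ?k"
  proof (rule cSup_eq_non_empty)
    show "{R. achievable C zrw zro zwo R} \<noteq> {}" using achievable_nonpos by blast
    show "R \<le> ?k" if "R \<in> {R. achievable C zrw zro zwo R}" for R
      using that assms achievable_le_unjammed[of zrw zwo C zro R] by simp
    show "?k \<le> y" if upper: "\<And>R. R \<in> {R. achievable C zrw zro zwo R} \<Longrightarrow> R \<le> y" for y
    proof (rule dense_le)
      fix R assume "R < ?k"
      moreover have "zrw + zro < C \<or> 2 * (zrw + zwo) < C" using False assms by linarith
      ultimately show "R \<le> y" using upper achievable_below_unjammed by blast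
    qed
  qed
  then show ?thesis unfolding capacity_def if_not_P[OF False] .
qed

end
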